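(* Let $(X,d)$ be a complete metric space with a convex-like structure $\{\gamma_\mu\}$. Then there is a linear embedding of $X$ into some vector space; that is, there exist a real vector space $V$ and an injective map $\iota\colon X\to V$ such that $\iota(\gamma_\mu(x_1,\ldots,x_n))=\sum_{i=1}^n\mu(i)\iota(x_i)$ for all $n\ge 1$, $\mu\in\mathrm{Prob}_n$ and $x_1,\ldots,x_n\in X$.
   Context: For $n\ge 1$, $\mathrm{Prob}_n$ denotes the set of probability measures on $\{1,\ldots,n\}$, endowed with the $\ell_1$-metric, and $X^{(n)}$ is the $n$-fold Cartesian product of $X$. A complete metric space $(X,d)$ has a convex-like structure if for every $n\ge 1$ and $\mu\in\mathrm{Prob}_n$ there is given a continuous map $\gamma_\mu\colon X^{(n)}\to X$ such that: (1) for each permutation $\sigma\in S_n$ and $x_1,\ldots,x_n\in X$, $\gamma_\mu(x_1,\ldots,x_n)=\gamma_{\mu\circ\sigma}(x_{\sigma(1)},\ldots,x_{\sigma(n)})$; (2) if $n\geq 2$ and $x_1=x_2$, then $\gamma_\mu(x_1,x_2,\ldots,x_n)=\gamma_{\tilde\mu}(x_1,x_3,\ldots,x_n)$, where $\tilde\mu\in\mathrm{Prob}_{n-1}$ is given by $\tilde\mu(1)=\mu(1)+\mu(2)$ and $\tilde\mu(j)=\mu(j+1)$ for $2\le j\le n-1$; (3) if $\mu(i)=1$, then $\gamma_\mu(x_1,\ldots,x_n)=x_i$; (4) for all $x_1,\ldots,x_n,y_1,\ldots,y_n\in X$, $d(\gamma_\mu(x_1,\ldots,x_n),\gamma_\mu(y_1,\ldots,y_n))\le\sum_{i=1}^n\mu(i)d(x_i,y_i)$;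 (5) for all $\nu\in\mathrm{Prob}_2$, $\mu\in\mathrm{Prob}_n$, $\tilde\mu\in\mathrm{Prob}_m$ and $x_1,\ldots,x_n,\tilde x_1,\ldots,\tilde x_m\in X$, $\gamma_\nu(\gamma_\mu(x_1,\ldots,x_n),\gamma_{\tilde\mu}(\tilde x_1,\ldots,\tilde x_m))=\gamma_\eta(x_1,\ldots,x_n,\tilde x_1,\ldots,\tilde x_m)$, where $\eta\in\mathrm{Prob}_{n+m}$ is given by $\eta(i)=\nu(1)\mu(i)$ for $1\le i\le n$ and $\eta(n+j)=\nu(2)\tilde\mu(j)$ for $1\le j\le m$. *)

theory Defs
  imports
    "HOL-Analysis.Analysis"
    "HOL-Combinatorics.Permutations"
    "HOL-Algebra.Module"
begin

text \<open>
  An $n$-tuple is a list of length $n$, with entries numbered from $0$, and a probability measure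
  on $n$ points is the list of its $n$ point masses. Note that \<^term>\<open>Prob 0\<close>, as defined below,
  is empty, so that every statement about \<^term>\<open>\<mu> \<in> Prob n\<close> is implicitly about $n \ge 1$.
\<close>

definition Prob :: "nat \<Rightarrow> real list set" where
  "Prob n = {\<mu>. length \<mu> = n \<and> (\<forall>p\<in>set \<mu>. 0 \<le> p) \<and> sum_list \<mu> = 1}"

text \<open>
  Continuity refers to the product topology on the $n$-fold power of the space, here presented as
  functions on the index set \<^term>\<open>{..<n}\<close>. In axiom \<open>perm\<close>,
  \<^term>\<open>permute_list \<sigma> xs\<close> has the entry \<^term>\<open>xs ! \<sigma> i\<close> at position \<^term>\<open>i\<close>.
\<close>

locale convex_like_structure =
  fixes \<gamma> :: "real list \<Rightarrow> 'a::complete_space list \<Rightarrow> 'a"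
  assumes continuous:
      "\<mu> \<in> Prob n \<Longrightarrow>
        continuous_map (product_topology (\<lambda>_. euclidean) {..<n}) euclidean
          (\<lambda>x. \<gamma> \<mu> (map x [0..<n]))"
    and perm:
      "\<mu> \<in> Prob n \<Longrightarrow> length xs = n \<Longrightarrow> \<sigma> permutes {..<n} \<Longrightarrow>
        \<gamma> \<mu> xs = \<gamma> (permute_list \<sigma> \<mu>) (permute_list \<sigma> xs)"
    and merge:
      "p # q # \<mu> \<in> Prob n \<Longrightarrow> length (x # x # xs) = n \<Longrightarrow>
        \<gamma> (p # q # \<mu>) (x # x # xs) = \<gamma> ((p + q) # \<mu>) (x # xs)"
    and dirac:
      "\<mu> \<in> Prob n \<Longrightarrow> length xs = n \<Longrightarrow> i < n \<Longrightarrow> \<mu> ! i = 1 \<Longrightarrow> \<gamma> \<mu> xs = xs ! i"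
    and dist_le:
      "\<mu> \<in> Prob n \<Longrightarrow> length xs = n \<Longrightarrow> length ys = n \<Longrightarrow>
        dist (\<gamma> \<mu> xs) (\<gamma> \<mu> ys) \<le> (\<Sum>i<n. \<mu> ! i * dist (xs ! i) (ys ! i))"
    and assoc:
      "[s, t] \<in> Prob 2 \<Longrightarrow> \<mu> \<in> Prob n \<Longrightarrow> \<mu>' \<in> Prob m \<Longrightarrow> length xs = n \<Longrightarrow> length ys = m \<Longrightarrow>
        \<gamma> [s, t] [\<gamma> \<mu> xs, \<gamma> \<mu>' ys] = \<gamma> (map ((*) s) \<mu> @ map ((*) t) \<mu>') (xs @ ys)"

definition real_field :: "real ring" where
  "real_field = \<lparr>carrier = UNIV, mult = (*), one = 1, zero = 0, add = (+)\<rparr>"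

lemma field_real_field: "field real_field"
proof -
  have "\<exists>y. x + y = 0" for x :: real
    by (rule exI[of _ "- x"]) simp
  then have "cring real_field"
    by (intro cringI abelian_groupI comm_monoidI)
      (auto simp: real_field_def algebra_simps)
  then interpret cring real_field .
  show ?thesis
    by (rule cring_fieldI2)
      (auto simp: real_field_def intro: exI[of _ "inverse _"] right_inverse)
qed

text \<open>
  A real vector space, with an arbitrary carrier set inside the type \<^typ>\<open>'v\<close>, is a module over the
  field of real numbers.
\<close>

abbreviation real_vector_space :: "(real, 'v) module \<Rightarrow> bool" where
  "real_vector_space V \<equiv> Module.module real_field V"

text \<open>
  HOL cannot quantify existentially over types, so an existence claim about vector spaces has to
  fix the type containing the carrier; the type \<open>'a \<Rightarrow> real\<close> loses no generality. Given a linear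
  embedding of \<open>'a\<close> into any real vector space, the span of its image has dimension at most the
  cardinality of \<open>'a\<close> and hence is isomorphic to a space of finitely supported functions
  \<open>'a \<Rightarrow> real\<close>.
\<close>

definition linear_embedding ::
  "(real list \<Rightarrow> 'a list \<Rightarrow> 'a) \<Rightarrow> (real, 'v) module \<Rightarrow> ('a \<Rightarrow> 'v) \<Rightarrow> bool" where
  "linear_embedding \<gamma> V \<iota> \<longleftrightarrow>
    \<iota> \<in> UNIV \<rightarrow> carrier V \<and> inj \<iota> \<and>
    (\<forall>n\<ge>1. \<forall>\<mu>\<in>Prob n. \<forall>xs. length xs = n \<longrightarrow>
      \<iota> (\<gamma> \<mu> xs) = (\<Oplus>\<^bsub>V\<^esub>i\<in>{..<n}. \<mu> ! i \<odot>\<^bsub>V\<^esub> \<iota> (xs ! i)))"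

end

theory Submission
  imports Defs "HOL-Library.Function_Algebras"
begin

text \<open>
  The embedding is the universal one. In the space of functions \<open>'a \<Rightarrow> real\<close>, let \<open>M\<close> consist of the
  multiples of differences of finitely supported probability weights with equal barycentres. By
  axiom \<open>assoc\<close> it is a subspace, so it is the kernel of a linear endomorphism, which is composed with
  \<open>x \<mapsto> \<delta>\<^sub>x\<close>. Injectivity means that \<open>\<delta>\<^sub>x - \<delta>\<^sub>y \<in> M\<close> only if \<open>x = y\<close>. Since barycentres depend only
  on the weights, this reduces to cancellation: if \<open>s x + (1 - s) z = s y + (1 - s) z\<close> for some
  \<open>s > 0\<close>, then the same holds for \<open>2 s / (1 + s)\<close> in place of \<open>s\<close>; iterating, \<open>s\<close> tends to \<open>1\<close> and
  the metric inequality \<open>dist_le\<close> gives \<open>x = y\<close>.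
\<close>

section \<open>Weighted lists\<close>

text \<open>The formal combination of point masses that a list stands for, as a function. Repeated
  points accumulate their masses, and \<open>weight [(1, x)]\<close> is the indicator \<delta> of
  \<open>x\<close>.\<close>

definition weight :: "(real \<times> 'a) list \<Rightarrow> 'a \<Rightarrow> real" where
  "weight zs y = (\<Sum>(p, x)\<leftarrow>zs. if x = y then p else 0)"

lemma weight_simps [simp]:
  "weight [] y = 0"
  "weight ((p, x) # zs) y = (if x = y then p else 0) + weight zs y"
  "weight (zs @ zs') y = weight zs y + weight zs' y"
  by (simp_all add: weight_def)

definition scale_weights :: "real \<Rightarrow> (real \<times> 'a) list \<Rightarrow> (real \<times> 'a) list" where
  "scale_weights s = map (\<lambda>(p, x). (s * p, x))"

lemma map_scale_weights [simp]:
  "map fst (scale_weights s zs) = map ((*) s) (map fst zs)"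
  "map snd (scale_weights s zs) = map snd zs"
  by (auto simp: scale_weights_def)

lemma weight_scale_weights [simp]: "weight (scale_weights s zs) y = s * weight zs y"
  by (induction zs) (auto simp: scale_weights_def algebra_simps)

definition weighted :: "(real \<times> 'a) list \<Rightarrow> bool" where
  "weighted zs \<longleftrightarrow> map fst zs \<in> Prob (length zs)"

lemma weighted_iff:
  "weighted zs \<longleftrightarrow> (\<forall>p\<in>set (map fst zs). 0 \<le> p) \<and> sum_list (map fst zs) = 1"
  by (auto simp: weighted_def Prob_def)

lemma weighted_cong_mset: "mset zs = mset zs' \<Longrightarrow> weighted zs \<longleftrightarrow> weighted zs'"
  by (metis weighted_iff mset_map set_mset_mset sum_mset_sum_list)

lemma weighted_zip: "\<mu> \<in> Prob n \<Longrightarrow> length xs = n \<Longrightarrow> weighted (zip \<mu> xs)"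
  by (simp add: weighted_def Prob_def)

lemma weighted_mix:
  assumes "weighted zs" "weighted zs'" "0 \<le> s" "0 \<le> t" "s + t = 1"
  shows "weighted (scale_weights s zs @ scale_weights t zs')"
  using assms unfolding weighted_iff
  by (auto simp: sum_list_const_mult simp flip: map_map)

section \<open>Barycentres\<close>

context convex_like_structure
begin

definition bary :: "(real \<times> 'a) list \<Rightarrow> 'a" where
  "bary zs = \<gamma> (map fst zs) (map snd zs)"

lemma bary_single [simp]: "bary [(1, x)] = x"
  using dirac[of "[1]" 1 "[x]" 0] by (simp add: bary_def Prob_def)

lemma bary_mix:
  assumes "weighted zs" "weighted zs'" "0 \<le> s" "0 \<le> t" "s + t = 1"
  shows "bary (scale_weights s zs @ scale_weights t zs') = \<gamma> [s, t] [bary zs, bary zs']"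
  using assms assoc[of s t "map fst zs" "length zs" "map fst zs'" "length zs'" "map snd zs" "map snd zs'"]
  by (auto simp: weighted_def bary_def Prob_def)

lemma bary_cong_mset:
  assumes "mset zs = mset zs'" "weighted zs'"
  shows "bary zs = bary zs'"
proof -
  obtain p where p: "p permutes {..<length zs'}" "permute_list p zs' = zs"
    using assms(1) by (rule mset_eq_permutation)
  have "bary zs' = \<gamma> (permute_list p (map fst zs')) (permute_list p (map snd zs'))"
    unfolding bary_def using assms(2) p(1) by (intro perm) (auto simp: weighted_def)
  also have "\<dots> = bary zs"
    using p by (simp add: bary_def permute_list_map)
  finally show ?thesis ..
qed

lemma bary_merge:
  assumes "weighted ((p, x) # (q, x) # zs)"
  shows "bary ((p, x) # (q, x) # zs) = bary ((p + q, x) # zs)"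
  using assms merge[of p q "map fst zs" "length zs + 2" x "map snd zs"]
  by (simp add: bary_def weighted_def)

text \<open>The longer list is a mixture of \<open>zs\<close> with another weighted list in
  proportions 1 and 0, and \<open>dirac\<close> discards the second component.\<close>

lemma bary_append_zeros:
  assumes "weighted zs"
  shows "bary (zs @ map (Pair 0) xs) = bary zs"
proof (cases xs)
  case (Cons x xs')
  \<comment> \<open>\<open>bary_mix\<close> needs a list of total mass 1 before scaling by 0, so the
    whole mass is put on the first appended point.\<close>
  define zs' where "zs' = (1 :: real, x) # map (Pair 0) xs'"
  have "weighted zs'"
    by (auto simp: weighted_iff zs'_def comp_def)
  then have "bary (scale_weights 1 zs @ scale_weights 0 zs') = \<gamma> [1, 0] [bary zs, bary zs']"
    using assms by (intro bary_mix) auto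
  also have "\<dots> = bary zs"
    using dirac[of "[1, 0]" 2 "[bary zs, bary zs']" 0] by (simp add: Prob_def)
  also have "scale_weights 1 zs @ scale_weights 0 zs' = zs @ map (Pair 0) xs"
    by (simp add: scale_weights_def zs'_def Cons)
  finally show ?thesis .
qed simp

text \<open>The entries of \<open>zs\<close> are merged one by one into the entry of
  \<open>xs\<close> at the same point. The masses \<open>f\<close> on \<open>xs\<close> are
  arbitrary because they grow during the induction.\<close>

lemma bary_absorb:
  assumes "weighted (zs @ map (\<lambda>x. (f x, x)) xs)" "distinct xs" "snd ` set zs \<subseteq> set xs"
  shows "bary (zs @ map (\<lambda>x. (f x, x)) xs) = bary (map (\<lambda>x. (f x + weight zs x, x)) xs)"
  using assms
proof (induction zs arbitrary: f)
  case (Cons z zs)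
  obtain p x where z: "z = (p, x)"
    by fastforce
  obtain xs1 xs2 where xs: "xs = xs1 @ x # xs2"
    using Cons.prems(3) z by (auto dest: split_list)
  have x: "x \<notin> set xs1" "x \<notin> set xs2"
    using Cons.prems(2) xs by auto
  define g where "g = f(x := p + f x)"
  define rest where "rest = zs @ map (\<lambda>x. (f x, x)) (xs1 @ xs2)"
  have 1: "mset (z # zs @ map (\<lambda>x. (f x, x)) xs) = mset ((p, x) # (f x, x) # rest)"
    by (simp add: z xs rest_def)
  have w: "weighted ((p, x) # (f x, x) # rest)"
    using Cons.prems(1) weighted_cong_mset[OF 1] by simp
  have g: "map (\<lambda>x. (g x, x)) xs = map (\<lambda>x. (f x, x)) xs1 @ (p + f x, x) # map (\<lambda>x. (f x, x)) xs2"
    using x by (auto simp: g_def xs)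
  have 2: "mset (zs @ map (\<lambda>x. (g x, x)) xs) = mset ((p + f x, x) # rest)"
    unfolding g by (simp add: rest_def)
  have w': "weighted ((p + f x, x) # rest)"
    using w by (auto simp: weighted_iff)
  have "bary (z # zs @ map (\<lambda>x. (f x, x)) xs) = bary ((p + f x, x) # rest)"
    using bary_cong_mset[OF 1 w] bary_merge[OF w] by simp
  also have "\<dots> = bary (zs @ map (\<lambda>x. (g x, x)) xs)"
    using bary_cong_mset[OF 2 w'] by simp
  also have "\<dots> = bary (map (\<lambda>x. (g x + weight zs x, x)) xs)"
    using Cons.prems w' weighted_cong_mset[OF 2] by (intro Cons.IH) auto
  also have "map (\<lambda>x. (g x + weight zs x, x)) xs = map (\<lambda>x. (f x + weight (z # zs) x, x)) xs"
    by (auto simp: g_def z)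
  finally show ?case
    by simp
qed simp

lemma bary_normal_form:
  assumes "weighted zs" "distinct xs" "snd ` set zs \<subseteq> set xs"
  shows "bary zs = bary (map (\<lambda>x. (weight zs x, x)) xs)"
proof -
  have "weighted (zs @ map (Pair 0) xs)"
    using assms(1) by (auto simp: weighted_iff comp_def)
  then show ?thesis
    using bary_append_zeros[OF assms(1), of xs] bary_absorb[of zs "\<lambda>_. 0" xs] assms(2,3) by simp
qed

text \<open>Both lists have a normal form over one common list of distinct points containing all
  their points, and that form is determined by the weights alone.\<close>

lemma bary_cong_weight:
  assumes "weighted zs" "weighted zs'" "weight zs = weight zs'"
  shows "bary zs = bary zs'"
proof -
  define xs where "xs = remdups (map snd (zs @ zs'))"
  have xs: "distinct xs" "snd ` set zs \<subseteq> set xs" "snd ` set zs' \<subseteq> set xs"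
    by (auto simp: xs_def)
  show ?thesis
    using bary_normal_form[OF assms(1) xs(1,2)] bary_normal_form[OF assms(2) xs(1,3)] assms(3)
    by simp
qed

section \<open>Cancellation\<close>

text \<open>By merging, \<open>x\<close> is the barycentre of \<open>x\<close> taken twice with
  masses \<open>s\<close> and \<open>t\<close>. In \<open>dist_le\<close> only the term comparing
  \<open>z\<close> with \<open>x\<close> then survives.\<close>

lemma dist_bary_pair:
  assumes "0 \<le> s" "0 \<le> t" "s + t = 1"
  shows "dist (bary [(s, x), (t, z)]) x \<le> t * dist z x"
proof -
  have st: "[s, t] \<in> Prob 2"
    using assms by (simp add: Prob_def)
  have "x = bary [(s, x), (t, x)]"
    using assms bary_merge[of s x t "[]"] by (simp add: weighted_iff)
  then have "dist (bary [(s, x), (t, z)]) x = dist (\<gamma> [s, t] [x, z]) (\<gamma> [s, t] [x, x])"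
    by (simp add: bary_def)
  also have "\<dots> \<le> t * dist z x"
    using dist_le[OF st, of "[x, z]" "[x, x]"] by (simp add: numeral_2_eq_2)
  finally show ?thesis .
qed

text \<open>The parameter \<open>r\<close> is the ratio of the mass of \<open>z\<close> to that of
  the other point. With \<open>s = 1 / (1 + r)\<close>, passing from \<open>s\<close> to
  \<open>2 s / (1 + s)\<close> is the same as halving \<open>r\<close>.\<close>

lemma bary_pair_double:
  assumes "0 \<le> r"
    and eq: "bary [(1 / (1 + r), x), (r / (1 + r), z)] = bary [(1 / (1 + r), y), (r / (1 + r), z)]"
  defines "q \<equiv> r / 2"
  shows "bary [(1 / (1 + q), x), (q / (1 + q), z)] = bary [(1 / (1 + q), y), (q / (1 + q), z)]"
proof -
  have "0 \<le> q"
    using \<open>0 \<le> r\<close> by (simp add: q_def)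
  \<comment> \<open>Chosen so that \<open>b / (1 + r) = a\<close>: in \<open>Y u v\<close> below,
    \<open>u\<close> and \<open>v\<close> carry the same mass \<open>a\<close>, and \<open>z\<close>
    carries \<open>r / (2 + r)\<close>.\<close>
  define a b where "a = 1 / (2 + r)" and "b = (1 + r) / (2 + r)"
  have ab: "0 \<le> a" "0 \<le> b" "a + b = 1"
    using \<open>0 \<le> r\<close> by (simp_all add: a_def b_def field_simps)
  define Z where "Z u = [(1 / (1 + r), u), (r / (1 + r), z)]" for u
  define Y where "Y u v = scale_weights a [(1, u)] @ scale_weights b (Z v)" for u v
  have Z: "weighted (Z u)" and single: "weighted [(1, u)]" for u :: 'a
    using \<open>0 \<le> r\<close> by (auto simp: weighted_iff Z_def field_simps)
  have Y: "weighted (Y u v)" for u v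
    unfolding Y_def using Z single ab by (intro weighted_mix)
  \<comment> \<open>The barycentre of \<open>Y u v\<close> depends on \<open>v\<close> only through
    \<open>bary (Z v)\<close>, which \<open>eq\<close> makes equal for \<open>x\<close> and
    \<open>y\<close>.\<close>
  have swap: "bary (Y u x) = bary (Y u y)" for u
    unfolding Y_def using bary_mix[OF single Z ab] eq by (simp add: Z_def)
  have b: "b * (1 / (1 + r)) = a"
    using \<open>0 \<le> r\<close> by (simp add: a_def b_def)
  have comm: "bary (Y u v) = bary (Y v u)" for u v
  proof (rule bary_cong_weight[OF Y Y])
    show "weight (Y u v) = weight (Y v u)"
      using b by (auto simp: fun_eq_iff Y_def Z_def algebra_simps)
  qed
  have "bary (Y u u) = bary [(1 / (1 + q), u), (q / (1 + q), z)]" for u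
  proof (rule bary_cong_weight[OF Y])
    show "weighted [(1 / (1 + q), u), (q / (1 + q), z)]"
      using \<open>0 \<le> q\<close> by (simp add: weighted_iff flip: add_divide_distrib)
    have q: "1 + q = (2 + r) / 2"
      by (simp add: q_def)
    have "a + b * (1 / (1 + r)) = 1 / (1 + q)"
      unfolding b q a_def add_divide_distrib[symmetric] by simp
    moreover have "b * (r / (1 + r)) = q / (1 + q)"
      using \<open>0 \<le> r\<close> unfolding q by (simp add: b_def q_def)
    ultimately show "weight (Y u u) = weight [(1 / (1 + q), u), (q / (1 + q), z)]"
      by (auto simp: fun_eq_iff Y_def Z_def algebra_simps)
  qed
  \<comment> \<open>The chain is \<open>Y x x\<close>, \<open>Y x y\<close>, \<open>Y y x\<close>,
    \<open>Y y y\<close>, all with the same barycentre.\<close>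
  then show ?thesis
    using swap comm by metis
qed

lemma cancel:
  assumes "0 \<le> r"
    and eq: "bary [(1 / (1 + r), x), (r / (1 + r), z)] = bary [(1 / (1 + r), y), (r / (1 + r), z)]"
  shows "x = y"
proof -
  define q where "q n = r / 2 ^ n" for n
  define w where "w n u = bary [(1 / (1 + q n), u), (q n / (1 + q n), z)]" for n u
  have q: "0 \<le> q n" for n
    using \<open>0 \<le> r\<close> by (simp add: q_def)
  have w: "w n x = w n y" for n
  proof (induction n)
    case 0
    then show ?case
      using eq by (simp add: w_def q_def)
  next
    case (Suc n)
    then show ?case
      using bary_pair_double[OF q[of n], of x z y] by (simp add: w_def q_def mult.commute)
  qed
  \<comment> \<open>The common point \<open>w n x = w n y\<close> lies close to both
    \<open>x\<close> and \<open>y\<close>, since the mass of \<open>z\<close> in it is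
    small.\<close>
  have bound: "dist x y \<le> q n / (1 + q n) * (dist z x + dist z y)" for n
  proof -
    have "dist (w n u) u \<le> q n / (1 + q n) * dist z u" for u
      unfolding w_def using q[of n] by (intro dist_bary_pair) (auto simp: field_simps)
    from this[of x] this[of y] show ?thesis
      using dist_triangle3[of x y "w n x"] w[of n]
      by (simp add: distrib_left)
  qed
  have "q \<longlonglongrightarrow> 0"
    unfolding q_def by (rule LIMSEQ_divide_realpow_zero) simp
  then have "(\<lambda>n. q n / (1 + q n) * (dist z x + dist z y)) \<longlonglongrightarrow> 0 / (1 + 0) * (dist z x + dist z y)"
    by (intro tendsto_intros) auto
  then have "dist x y \<le> 0 / (1 + 0) * (dist z x + dist z y)"
    using bound by (intro LIMSEQ_le_const) auto
  then show ?thesis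
    by simp
qed

section \<open>The subspace of relations\<close>

text \<open>A single scaled difference is enough, since the closure lemmas below combine several
  into one. A nonnegative \<open>r\<close> is enough, since exchanging \<open>zs\<close> and
  \<open>zs'\<close> changes the sign.\<close>

definition relations :: "('a \<Rightarrow> real) set" where
  "relations = {f. \<exists>r zs zs'. 0 \<le> r \<and> weighted zs \<and> weighted zs' \<and> bary zs = bary zs' \<and>
    f = (\<lambda>x. r * (weight zs x - weight zs' x))}"

lemma relationsI:
  assumes "0 \<le> r" "weighted zs" "weighted zs'" "bary zs = bary zs'"
    "\<And>x. f x = r * (weight zs x - weight zs' x)"
  shows "f \<in> relations"
  using assms unfolding relations_def by blast

lemma relations_zero: "0 \<in> relations"
  by (rule relationsI[of 0 "[(1, undefined)]" "[(1, undefined)]"]) (auto simp: weighted_iff)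

lemma relations_scale:
  assumes "f \<in> relations"
  shows "(\<lambda>x. c * f x) \<in> relations"
proof -
  obtain r zs zs' where *: "0 \<le> r" "weighted zs" "weighted zs'" "bary zs = bary zs'"
    "f = (\<lambda>x. r * (weight zs x - weight zs' x))"
    using assms by (auto simp: relations_def)
  show ?thesis
  proof (cases "0 \<le> c")
    case True
    then show ?thesis
      using * by (intro relationsI[of "c * r" zs zs']) auto
  next
    case False
    then show ?thesis
      using * by (intro relationsI[of "- c * r" zs' zs]) (auto simp: algebra_simps mult_nonpos_nonneg)
  qed
qed

text \<open>The positive parts are mixed in proportion \<open>r : s\<close>, and likewise the
  negative parts. \<open>bary_mix\<close> shows that the mixtures have equal barycentres, and the
  factor \<open>r + s\<close> restores the sum.\<close>

lemma relations_add:
  assumes "f \<in> relations" "g \<in> relations"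
  shows "f + g \<in> relations"
proof -
  obtain r A A' where f: "0 \<le> r" "weighted A" "weighted A'" "bary A = bary A'"
    "f = (\<lambda>x. r * (weight A x - weight A' x))"
    using assms(1) by (auto simp: relations_def)
  obtain s B B' where g: "0 \<le> s" "weighted B" "weighted B'" "bary B = bary B'"
    "g = (\<lambda>x. s * (weight B x - weight B' x))"
    using assms(2) by (auto simp: relations_def)
  show ?thesis
  proof (cases "r + s = 0")
    case True
    then have "r = 0" "s = 0"
      using f(1) g(1) by auto
    then show ?thesis
      using relations_zero f(5) g(5) by (simp add: plus_fun_def zero_fun_def)
  next
    case False
    define a b where "a = r / (r + s)" and "b = s / (r + s)"
    have ab: "0 \<le> a" "0 \<le> b" "a + b = 1" and r: "(r + s) * a = r" and s: "(r + s) * b = s"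
      using f(1) g(1) False by (auto simp: a_def b_def simp flip: add_divide_distrib)
    show ?thesis
    proof (rule relationsI)
      show "0 \<le> r + s"
        using f(1) g(1) by simp
      show "weighted (scale_weights a A @ scale_weights b B)"
        "weighted (scale_weights a A' @ scale_weights b B')"
        using f g ab by (auto intro: weighted_mix)
      show "bary (scale_weights a A @ scale_weights b B) = bary (scale_weights a A' @ scale_weights b B')"
        using f g ab by (simp add: bary_mix)
      show "(f + g) x = (r + s) * (weight (scale_weights a A @ scale_weights b B) x -
        weight (scale_weights a A' @ scale_weights b B') x)" for x
      proof -
        have "(f + g) x = ((r + s) * a) * (weight A x - weight A' x) + ((r + s) * b) * (weight B x - weight B' x)"
          unfolding r s by (simp add: f(5) g(5))
        then show ?thesis
          by (simp add: algebra_simps)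
      qed
    qed
  qed
qed

lemma relations_bary:
  assumes "weighted zs"
  shows "weight [(1, bary zs)] - weight zs \<in> relations"
  using assms by (intro relationsI[of 1 "[(1, bary zs)]" zs]) (auto simp: weighted_iff)

text \<open>Moving negative terms across gives \<delta>_x + r B = \<delta>_y + r A. Division by
  \<open>1 + r\<close> turns both sides into probability weights with equal barycentres, and
  \<open>cancel\<close> applies with the common barycentre of \<open>A\<close> and \<open>B\<close>
  as third point.\<close>

lemma relations_diracD:
  assumes "weight [(1, x)] - weight [(1, y)] \<in> relations"
  shows "x = y"
proof -
  obtain r A B where *: "0 \<le> r" "weighted A" "weighted B" "bary A = bary B"
    and eq: "weight [(1, x)] - weight [(1, y)] = (\<lambda>u. r * (weight A u - weight B u))"
    using assms by (auto simp: relations_def)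
  define s t where "s = 1 / (1 + r)" and "t = r / (1 + r)"
  have st: "0 \<le> s" "0 \<le> t" "s + t = 1" and t: "t = s * r"
    using * by (auto simp: s_def t_def simp flip: add_divide_distrib)
  have single: "weighted [(1, u)]" for u :: 'a
    by (simp add: weighted_iff)
  have bary: "bary (scale_weights s [(1, u)] @ scale_weights t zs) = bary [(s, u), (t, bary zs)]"
    if "weighted zs" for u zs
    by (subst bary_mix[OF single that st]) (simp add: bary_def[of "[(s, u), (t, bary zs)]"])
  have "bary (scale_weights s [(1, x)] @ scale_weights t B) =
    bary (scale_weights s [(1, y)] @ scale_weights t A)"
  proof (rule bary_cong_weight)
    have "weight [(1, x)] u + r * weight B u = weight [(1, y)] u + r * weight A u" for u
      using fun_cong[OF eq, of u] by (simp add: algebra_simps)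
    then have "s * (weight [(1, x)] u + r * weight B u) = s * (weight [(1, y)] u + r * weight A u)" for u
      by simp
    then show "weight (scale_weights s [(1, x)] @ scale_weights t B) =
      weight (scale_weights s [(1, y)] @ scale_weights t A)"
      by (simp add: fun_eq_iff t algebra_simps del: weight_simps(2))
  qed (use * st single in \<open>auto intro: weighted_mix\<close>)
  then show ?thesis
    using *(1) cancel[of r x "bary B" y] by (simp add: bary[unfolded s_def t_def] * s_def t_def)
qed

end

section \<open>The vector space\<close>

text \<open>\<open>P\<close> is the projection along \<open>M\<close> that kills a basis of
  \<open>M\<close> and fixes the vectors extending it to a basis of the whole space. It replaces the
  quotient by \<open>M\<close> without leaving the original space.\<close>

lemma (in vector_space) subspace_eq_kernel:
  assumes "subspace M"
  obtains P where "Vector_Spaces.linear scale scale P" "\<And>v. P v = 0 \<longleftrightarrow> v \<in> M"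
proof -
  interpret vector_space_pair scale scale ..
  obtain B where B: "B \<subseteq> M" "independent B" "M \<subseteq> span B"
    by (rule maximal_independent_subset)
  define C where "C = extend_basis B"
  have C: "B \<subseteq> C" "independent C" "span C = UNIV"
    using B(2) by (auto simp: C_def extend_basis_superset independent_extend_basis)
  define P where "P = construct C (\<lambda>b. if b \<in> B then 0 else b)"
  have P: "Vector_Spaces.linear scale scale P"
    unfolding P_def using C(2) by (rule linear_construct)
  then interpret P: Vector_Spaces.linear scale scale P .
  have P_C: "P b = (if b \<in> B then 0 else b)" if "b \<in> C" for b
    unfolding P_def using C(2) that by (rule construct_basis)
  have "P v = 0" if "v \<in> M" for v
  proof -
    have "v \<in> span B"
      using that B(3) by blast
    then show ?thesis
      by (rule P.eq_0_on_span[rotated]) (use C(1) P_C in auto)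
  qed
  \<comment> \<open>This gives the converse inclusion: if \<open>P v = 0\<close>, then
    \<open>v\<close> itself lies in \<open>M\<close>.\<close>
  moreover have "v - P v \<in> M" for v
  proof -
    have "v \<in> span C"
      using C(3) by simp
    then show ?thesis
    proof (induction rule: span_induct_alt)
      case base
      then show ?case
        using assms by (simp add: subspace_0)
    next
      case (step c b w)
      have "b - P b \<in> M"
        using step(1) P_C B(1) assms by (auto simp: subspace_0)
      then have "scale c (b - P b) + (w - P w) \<in> M"
        using step(2) assms by (intro subspace_add subspace_scale)
      then show ?case
        by (simp add: P.add P.scale scale_right_diff_distrib algebra_simps)
    qed
  qed
  ultimately have "P v = 0 \<longleftrightarrow> v \<in> M" for v
    by (metis diff_zero)
  with P show thesis
    by (rule that)
qed

definition real_function_space :: "(real, 'a \<Rightarrow> real) module" where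
  "real_function_space = \<lparr>carrier = UNIV, mult = (*), one = 1, zero = 0, add = (+),
    smult = (\<lambda>c f x. c * f x)\<rparr>"

lemma module_real_function_space: "real_vector_space (real_function_space :: (real, 'a \<Rightarrow> real) module)"
proof (rule moduleI)
  show "cring real_field"
    using field_real_field by (simp add: field_def domain_def)
  have "\<exists>g. f + g = 0" for f :: "'a \<Rightarrow> real"
    by (rule exI[of _ "- f"]) simp
  then show "abelian_group (real_function_space :: (real, 'a \<Rightarrow> real) module)"
    by (intro abelian_groupI) (auto simp: real_function_space_def algebra_simps)
qed (auto simp: real_function_space_def real_field_def fun_eq_iff algebra_simps)

lemma finsum_real_function_space:
  fixes f :: "'i \<Rightarrow> 'a \<Rightarrow> real"
  assumes "finite I"
  shows "finsum real_function_space f I = sum f I"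
  using assms
proof (induction I rule: finite_induct)
  interpret V: Module.module real_field "real_function_space :: (real, 'a \<Rightarrow> real) module"
    by (rule module_real_function_space)
  case empty
  then show ?case
    by (subst V.finsum_empty) (simp add: real_function_space_def)
next
  interpret V: Module.module real_field "real_function_space :: (real, 'a \<Rightarrow> real) module"
    by (rule module_real_function_space)
  case (insert i I)
  then show ?case
    by (subst V.finsum_insert) (auto simp: real_function_space_def)
qed

text \<open>Writes the weights as a linear combination of indicators, the form to which a linear map
  can be applied termwise.\<close>

lemma weight_zip:
  assumes "length xs = n" "length \<mu> = n"
  shows "weight (zip \<mu> xs) = (\<Sum>i<n. (\<lambda>y. \<mu> ! i * weight [(1, xs ! i)] y))"
proof
  fix y
  have sum_apply: "(\<Sum>i\<in>I. h i) y = (\<Sum>i\<in>I. h i y)" if "finite I" for I and h :: "nat \<Rightarrow> 'a \<Rightarrow> real"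
    using that by (induction I rule: finite_induct) auto
  have "weight (zip \<mu> xs) y = (\<Sum>i<n. if xs ! i = y then \<mu> ! i else 0)"
    using assms by (auto simp: weight_def sum_list_sum_nth atLeast0LessThan intro!: sum.cong)
  also have "\<dots> = (\<Sum>i<n. (\<lambda>y. \<mu> ! i * weight [(1, xs ! i)] y)) y"
    by (subst sum_apply) (auto intro!: sum.cong)
  finally show "weight (zip \<mu> xs) y = \<dots>" .
qed

theorem corollary6:
  fixes \<gamma> :: "real list \<Rightarrow> 'a::complete_space list \<Rightarrow> 'a"
  assumes "convex_like_structure \<gamma>"
  shows "\<exists>(V :: (real, 'a \<Rightarrow> real) module) \<iota>. real_vector_space V \<and> linear_embedding \<gamma> V \<iota>"
proof -
  interpret convex_like_structure \<gamma>
    by fact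
  define scale :: "real \<Rightarrow> ('a \<Rightarrow> real) \<Rightarrow> 'a \<Rightarrow> real" where "scale = (\<lambda>c f x. c * f x)"
  interpret W: vector_space scale
    by unfold_locales (auto simp: scale_def fun_eq_iff algebra_simps)
  have "W.subspace relations"
    unfolding W.subspace_def using relations_zero relations_add relations_scale
    by (auto simp: scale_def)
  then obtain P where P: "Vector_Spaces.linear scale scale P"
    and ker: "\<And>v. P v = 0 \<longleftrightarrow> v \<in> relations"
    using W.subspace_eq_kernel by blast
  interpret P: Vector_Spaces.linear scale scale P
    by (rule P)
  \<comment> \<open>The class of \<delta>_x modulo \<open>relations\<close>, represented by its
    image under \<open>P\<close>.\<close>
  define \<iota> where "\<iota> x = P (weight [(1, x)])" for x
  have "inj \<iota>"
  proof (rule injI)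
    fix x y
    assume "\<iota> x = \<iota> y"
    then have "P (weight [(1, x)] - weight [(1, y)]) = 0"
      by (simp add: \<iota>_def P.diff)
    then show "x = y"
      by (intro relations_diracD) (simp only: ker)
  qed
  moreover have "\<iota> (\<gamma> \<mu> xs) =
      (\<Oplus>\<^bsub>real_function_space\<^esub>i\<in>{..<n}. \<mu> ! i \<odot>\<^bsub>real_function_space\<^esub> \<iota> (xs ! i))"
    if "\<mu> \<in> Prob n" "length xs = n" for n \<mu> xs
  proof -
    have len: "length \<mu> = n"
      using that(1) by (simp add: Prob_def)
    have "bary (zip \<mu> xs) = \<gamma> \<mu> xs"
      using len that(2) by (simp add: bary_def)
    then have "P (weight [(1, \<gamma> \<mu> xs)] - weight (zip \<mu> xs)) = 0"
      using relations_bary[OF weighted_zip[OF that]] ker by simp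
    then have "\<iota> (\<gamma> \<mu> xs) = P (weight (zip \<mu> xs))"
      by (simp add: \<iota>_def P.diff)
    also have "weight (zip \<mu> xs) = (\<Sum>i<n. scale (\<mu> ! i) (weight [(1, xs ! i)]))"
      using weight_zip[OF that(2) len] by (simp add: scale_def)
    also have "P \<dots> = (\<Sum>i<n. scale (\<mu> ! i) (\<iota> (xs ! i)))"
      by (simp add: P.sum P.scale \<iota>_def)
    also have "\<dots> = (\<Oplus>\<^bsub>real_function_space\<^esub>i\<in>{..<n}. \<mu> ! i \<odot>\<^bsub>real_function_space\<^esub> \<iota> (xs ! i))"
      by (subst finsum_real_function_space) (auto simp: real_function_space_def scale_def)
    finally show ?thesis .
  qed
  ultimately have "linear_embedding \<gamma> real_function_space \<iota>"
    by (auto simp: linear_embedding_def real_function_space_def)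
  with module_real_function_space show ?thesis
    by blast
qed

end
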